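(* For every integer $k \ge 2$, there exist infinitely many (pairwise non-isomorphic) Cayley nut graphs $G$ with $o_e(G) = o_a(G) = k$.
   Context: All graphs are finite, simple and undirected. A nut graph is a graph with at least two vertices whose adjacency matrix has a one-dimensional null space spanned by a vector with no zero entries. For a graph $G$, $o_v(G)$, $o_e(G)$ and $o_a(G)$ denote the number of orbits of the automorphism group $\mathrm{Aut}\,G$ on the vertex set, on the edge set, and on the arc set (ordered pairs $(u,v)$ of adjacent vertices), respectively. A Cayley graph is a graph $\mathrm{Cay}(\Gamma,S)$ on a group $\Gamma$ with inverse-closed connection set $S \subseteq \Gamma\setminus\{e\}$, with $g \sim h$ iff $g^{-1}h \in S$. *)

theory Defs
  imports
    "HOL-Library.Function_Algebras"
    "HOL-Algebra.Group_Action"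
    "Graph_Theory.Pair_Digraph"
    "Graph_Theory.Digraph_Isomorphism"
begin

text \<open>
  A finite simple undirected graph is a \<open>pair_pre_digraph\<close> satisfying the locale predicate
  \<open>pair_graph\<close>: finite vertex set, irreflexive and symmetric arc relation.  Its arcs are the
  ordered pairs of adjacent vertices.  Isomorphism of graphs is \<open>digraph_iso\<close> of the underlying
  digraphs.
\<close>

definition edges :: "'a pair_pre_digraph \<Rightarrow> 'a set set" where
  "edges G = (\<lambda>(u, v). {u, v}) ` parcs G"


subsection \<open>Automorphisms and orbits\<close>

definition aut_group :: "'a pair_pre_digraph \<Rightarrow> ('a \<Rightarrow> 'a) monoid" where
  "aut_group G = (BijGroup (pverts G))
     \<lparr>carrier := {f \<in> Bij (pverts G). \<forall>u \<in> pverts G. \<forall>v \<in> pverts G.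
        (f u, f v) \<in> parcs G \<longleftrightarrow> (u, v) \<in> parcs G}\<rparr>"

definition num_edge_orbits :: "'a pair_pre_digraph \<Rightarrow> nat" where
  "num_edge_orbits G = card (orbits (aut_group G) (edges G) (\<lambda>f e. f ` e))"

definition num_arc_orbits :: "'a pair_pre_digraph \<Rightarrow> nat" where
  "num_arc_orbits G = card (orbits (aut_group G) (parcs G) (\<lambda>f. map_prod f f))"

lemma subgroup_aut_group:
  "subgroup (carrier (aut_group G)) (BijGroup (pverts G))"
proof -
  interpret group "BijGroup (pverts G)"
    by (rule group_BijGroup)
  show ?thesis
  proof (rule subgroupI)
    show "carrier (aut_group G) \<subseteq> carrier (BijGroup (pverts G))"
      by (auto simp: aut_group_def BijGroup_def)
    have "(\<lambda>x \<in> pverts G. x) \<in> carrier (aut_group G)"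
      by (auto simp: aut_group_def id_Bij)
    then show "carrier (aut_group G) \<noteq> {}"
      by blast
  next
    fix f assume f: "f \<in> carrier (aut_group G)"
    then have fB: "f \<in> Bij (pverts G)"
      by (simp add: aut_group_def)
    then have im: "f ` pverts G = pverts G"
      by (simp add: Bij_def bij_betw_def)
    have "f (inv_into (pverts G) f u) = u" if "u \<in> pverts G" for u
      using that im by (simp add: f_inv_into_f)
    moreover have "inv_into (pverts G) f u \<in> pverts G" if "u \<in> pverts G" for u
      using that fB by (rule Bij_inv_into_mem[rotated])
    ultimately show "inv\<^bsub>BijGroup (pverts G)\<^esub> f \<in> carrier (aut_group G)"
      using f fB by (auto simp: aut_group_def inv_BijGroup restrict_inv_into_Bij) metis+
  next
    fix f g assume fg: "f \<in> carrier (aut_group G)" "g \<in> carrier (aut_group G)"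
    then have B: "f \<in> Bij (pverts G)" "g \<in> Bij (pverts G)"
      by (auto simp: aut_group_def)
    then have "g u \<in> pverts G" if "u \<in> pverts G" for u
      using that by (blast dest: Bij_imp_funcset)
    then show "f \<otimes>\<^bsub>BijGroup (pverts G)\<^esub> g \<in> carrier (aut_group G)"
      using fg B by (auto simp: aut_group_def BijGroup_def compose_Bij) (auto simp: compose_def)
  qed
qed

lemma group_aut_group: "group (aut_group G)"
  using group.subgroup_imp_group[OF group_BijGroup subgroup_aut_group, of G]
  by (simp add: aut_group_def)


subsection \<open>Nut graphs\<close>

text \<open>
  The adjacency matrix is indexed by the vertices themselves.  Real vectors indexed by the vertex
  set are functions that vanish off that set; they form a subspace of the vector space of all
  real-valued functions.
\<close>

interpretation fun_space: vector_space "\<lambda>(c :: real) (x :: 'a \<Rightarrow> real) v. c * x v"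
  by unfold_locales (auto simp: fun_eq_iff algebra_simps)

definition adjacency_matrix :: "'a pair_pre_digraph \<Rightarrow> 'a \<Rightarrow> 'a \<Rightarrow> real" where
  "adjacency_matrix G u v = (if (u, v) \<in> parcs G then 1 else 0)"

definition null_space :: "'a pair_pre_digraph \<Rightarrow> ('a \<Rightarrow> real) set" where
  "null_space G = {x. (\<forall>v. v \<notin> pverts G \<longrightarrow> x v = 0) \<and>
     (\<forall>u \<in> pverts G. (\<Sum>v \<in> pverts G. adjacency_matrix G u v * x v) = 0)}"

lemma subspace_null_space: "fun_space.subspace (null_space G)"
proof (rule fun_space.subspaceI)
  fix c :: real and x assume "x \<in> null_space G"
  then show "(\<lambda>v. c * x v) \<in> null_space G"
    by (auto simp: null_space_def mult.left_commute[of _ c] simp flip: sum_distrib_left)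
qed (auto simp: null_space_def algebra_simps sum.distrib)

definition nut_graph :: "'a pair_pre_digraph \<Rightarrow> bool" where
  "nut_graph G \<longleftrightarrow> pair_graph G \<and> 2 \<le> card (pverts G) \<and>
     fun_space.dim (null_space G) = 1 \<and>
     (\<exists>x. (\<forall>v \<in> pverts G. x v \<noteq> 0) \<and> null_space G = fun_space.span {x})"


subsection \<open>Cayley graphs\<close>

definition Cay :: "('a, 'm) monoid_scheme \<Rightarrow> 'a set \<Rightarrow> 'a pair_pre_digraph" where
  "Cay \<Gamma> S = \<lparr>pverts = carrier \<Gamma>,
     parcs = {(g, h) \<in> carrier \<Gamma> \<times> carrier \<Gamma>. inv\<^bsub>\<Gamma>\<^esub> g \<otimes>\<^bsub>\<Gamma>\<^esub> h \<in> S}\<rparr>"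

definition cayley_graph :: "'a pair_pre_digraph \<Rightarrow> bool" where
  "cayley_graph G \<longleftrightarrow> (\<exists>(\<Gamma> :: 'a monoid) S.
     group \<Gamma> \<and> finite (carrier \<Gamma>) \<and> S \<subseteq> carrier \<Gamma> - {\<one>\<^bsub>\<Gamma>\<^esub>} \<and>
     (\<forall>s \<in> S. inv\<^bsub>\<Gamma>\<^esub> s \<in> S) \<and> G = Cay \<Gamma> S)"

lemma pair_graph_cayley_graph:
  assumes "cayley_graph G"
  shows "pair_graph G"
proof -
  obtain \<Gamma> :: "'a monoid" and S where \<Gamma>: "group \<Gamma>" "finite (carrier \<Gamma>)"
    and S: "S \<subseteq> carrier \<Gamma> - {\<one>\<^bsub>\<Gamma>\<^esub>}" "\<And>s. s \<in> S \<Longrightarrow> inv\<^bsub>\<Gamma>\<^esub> s \<in> S"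
    and G: "G = Cay \<Gamma> S"
    using assms by (auto simp: cayley_graph_def)
  interpret group \<Gamma> by fact
  have sym: "inv\<^bsub>\<Gamma>\<^esub> h \<otimes>\<^bsub>\<Gamma>\<^esub> g \<in> S"
    if "g \<in> carrier \<Gamma>" "h \<in> carrier \<Gamma>" "inv\<^bsub>\<Gamma>\<^esub> g \<otimes>\<^bsub>\<Gamma>\<^esub> h \<in> S" for g h
    using S(2)[OF that(3)] that(1,2) by (simp add: inv_mult_group)
  show ?thesis
  proof
    show "finite (parcs G)"
      by (rule finite_subset[of _ "carrier \<Gamma> \<times> carrier \<Gamma>"]) (auto simp: G Cay_def \<Gamma>(2))
    show "symmetric (with_proj G)"
      using sym by (auto simp: symmetric_def sym_def G Cay_def)
  next
    fix e assume "e \<in> parcs G"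
    then show "fst e \<noteq> snd e"
      using S(1) by (auto simp: G Cay_def)
  qed (auto simp: G Cay_def \<Gamma>(2))
qed

end

theory Submission
  imports Defs "HOL-Combinatorics.Transposition"
begin

text \<open>
  Take the Cartesian product of complete graphs on $n_0, \dots, n_{r-1}$ vertices and of the
  complete bipartite graph $K_{d,d}$ with $d = \sum_i (n_i - 1)$, where the $n_i$ are distinct and
  larger than $r$ and $2$.  The eigenvalues are the sums of $\sum_{i \in B} n_i - r$, for a set $B$
  of indices, and of one of $d$, $0$, $-d$.  As $\sum_i n_i = d + r$ and no $B$ has sum $r$, the
  eigenvalue $0$ arises only from the trivial eigenvectors of all cliques and the sign vector
  of the bipartition, so the kernel is spanned by a vector with entries $\pm 1$.

  Permutations of single coordinates act transitively on the arcs in each of the $r + 1$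
  directions.  Different directions lie in different orbits because an edge in direction $i$ is in
  $n_i - 2$ triangles, and an edge in the bipartite direction is in none.  With $k = r + 1$, letting
  the $n_i$ grow gives infinitely many graphs.
\<close>

text \<open>The hypotheses make the orbit of \<open>x\<close> the fibre of \<open>\<delta>\<close>
  through \<open>x\<close>, so orbits correspond to values of \<open>\<delta>\<close>. A complete
  invariant thus reduces the orbit count to counting its values.\<close>

lemma card_orbits_eq:
  assumes "\<And>x y. x \<in> E \<Longrightarrow> y \<in> E \<Longrightarrow> y \<in> orbit H \<phi> x \<longleftrightarrow> \<delta> x = \<delta> y"
    and "\<And>x. x \<in> E \<Longrightarrow> orbit H \<phi> x \<subseteq> E"
  shows "card (orbits H E \<phi>) = card (\<delta> ` E)"
proof -
  have "orbit H \<phi> x = {y \<in> E. \<delta> y = \<delta> x}" if "x \<in> E" for x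
    using assms(1)[OF that] assms(2)[OF that] by force
  then have "orbits H E \<phi> = (\<lambda>t. {y \<in> E. \<delta> y = t}) ` \<delta> ` E"
    unfolding orbits_def by (auto simp: image_iff)
  moreover have "inj_on (\<lambda>t. {y \<in> E. \<delta> y = t}) (\<delta> ` E)"
    by (rule inj_onI) blast
  ultimately show ?thesis by (simp add: card_image)
qed

text \<open>
  A vertex $v$ has coordinates \<open>c v 0, \<dots>, c v r\<close>.  Coordinate \<open>r\<close> is the one of $K_{d,d}$, whose
  parts are the even and the odd residues modulo $2d$; thus \<open>n r = 2 * d\<close>.
\<close>

locale clique_biclique_product =
  fixes r :: nat and n :: "nat \<Rightarrow> nat" and V :: "'a set" and c :: "'a \<Rightarrow> nat \<Rightarrow> int"
  assumes bij_c: "bij_betw c V (PiE {..r} (\<lambda>i. {0..<int (n i)}))"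
    and r_pos: "1 \<le> r"
    and n_gt: "i < r \<Longrightarrow> r < n i"
    and n_ge_3: "i < r \<Longrightarrow> 3 \<le> n i"
    and inj_n: "inj_on n {..<r}"
    and n_r: "n r = 2 * (\<Sum>i<r. n i - 1)"
begin

section \<open>The product graph in coordinates\<close>

abbreviation F :: "(nat \<Rightarrow> int) set" where
  "F \<equiv> PiE {..r} (\<lambda>i. {0..<int (n i)})"

definition R :: "nat \<Rightarrow> int \<Rightarrow> int \<Rightarrow> bool" where
  "R i a b \<longleftrightarrow> (if i = r then odd (a - b) else a \<noteq> b)"

text \<open>Neighbours are written as updates of one coordinate so that a sum over them splits into
  sums over the directions; \<open>nbr_iff\<close> gives the symmetric form.\<close>

definition nbr :: "(nat \<Rightarrow> int) \<Rightarrow> (nat \<Rightarrow> int) \<Rightarrow> bool" where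
  "nbr f g \<longleftrightarrow> (\<exists>i\<le>r. \<exists>a\<in>{0..<int (n i)}. R i (f i) a \<and> g = f(i := a))"

definition G :: "'a pair_pre_digraph" where
  "G = \<lparr>pverts = V, parcs = {(u, v) \<in> V \<times> V. nbr (c u) (c v)}\<rparr>"

definition d :: nat where
  "d = (\<Sum>i<r. n i - 1)"

lemma n_last: "n r = 2 * d"
  by (simp add: n_r d_def)

lemma R_sym: "R i a b \<Longrightarrow> R i b a"
  by (auto simp: R_def)

lemma R_irrefl: "\<not> R i a a"
  by (auto simp: R_def)

text \<open>Each of the \<open>r\<close> summands is at least 2. The bound makes \<open>d\<close>
  nonzero and keeps \<open>r - d\<close> negative, below all subset sums.\<close>

lemma d_gt_r: "r < d"
proof -
  have "(\<Sum>i<r. 2) \<le> d"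
    unfolding d_def by (rule sum_mono) (use n_ge_3 in force)
  then show ?thesis using r_pos by simp
qed

lemma sum_n: "(\<Sum>i<r. n i) = d + r"
proof -
  have "(\<Sum>i<r. n i) = (\<Sum>i<r. (n i - 1) + 1)"
    by (rule sum.cong) (use n_ge_3 in force)+
  then show ?thesis unfolding d_def by (simp only: sum.distrib) simp
qed

lemma n_ge_2: "i \<le> r \<Longrightarrow> 2 \<le> n i"
  using n_ge_3[of i] n_last d_gt_r r_pos by (cases "i = r") auto

lemma n_gt_0: "i \<le> r \<Longrightarrow> 0 < n i"
  using n_ge_2[of i] by simp

lemma finite_F: "finite F"
  by (rule finite_PiE) auto

lemma upd_F: "f \<in> F \<Longrightarrow> i \<le> r \<Longrightarrow> a \<in> {0..<int (n i)} \<Longrightarrow> f(i := a) \<in> F"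
  by (auto simp: PiE_iff extensional_def)

lemma F_range: "f \<in> F \<Longrightarrow> i \<le> r \<Longrightarrow> f i \<in> {0..<int (n i)}"
  by auto

lemma c_F: "v \<in> V \<Longrightarrow> c v \<in> F"
  using bij_c by (auto simp: bij_betw_def)

lemma c_inject: "u \<in> V \<Longrightarrow> v \<in> V \<Longrightarrow> c u = c v \<longleftrightarrow> u = v"
  using bij_c by (auto simp: bij_betw_def inj_on_def)

text \<open>Since \<open>R\<close> is irreflexive, the update really changes coordinate
  \<open>i\<close>, so \<open>i\<close> and \<open>a\<close> can be read off from
  \<open>f(i := a)\<close> and no neighbour is counted twice.\<close>

lemma sum_nbr:
  fixes X :: "(nat \<Rightarrow> int) \<Rightarrow> real"
  assumes "f \<in> F"
  shows "(\<Sum>g | g \<in> F \<and> nbr f g. X g)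
    = (\<Sum>i\<le>r. \<Sum>a | a \<in> {0..<int (n i)} \<and> R i (f i) a. X (f(i := a)))"
proof -
  let ?S = "SIGMA i:{..r}. {a. a \<in> {0..<int (n i)} \<and> R i (f i) a}"
  have inj: "inj_on (\<lambda>(i, a). f(i := a)) ?S"
  proof (rule inj_onI, clarify)
    fix i a j b
    assume "R i (f i) a" "R j (f j) b" and eq: "f(i := a) = f(j := b)"
    then have "f i \<noteq> a" "f j \<noteq> b" using R_irrefl by auto
    then show "i = j \<and> a = b"
      using fun_cong[OF eq, of i] fun_cong[OF eq, of j] by (auto split: if_splits)
  qed
  have "{g. g \<in> F \<and> nbr f g} = (\<lambda>(i, a). f(i := a)) ` ?S"
    using assms upd_F[OF assms] by (fastforce simp: nbr_def)
  then have "(\<Sum>g | g \<in> F \<and> nbr f g. X g) = (\<Sum>(i, a)\<in>?S. X (f(i := a)))"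
    using inj by (simp add: sum.reindex case_prod_unfold)
  also have "\<dots> = (\<Sum>i\<le>r. \<Sum>a | a \<in> {0..<int (n i)} \<and> R i (f i) a. X (f(i := a)))"
    by (subst sum.Sigma) (auto intro: finite_subset[of _ "{0..<int (n _)}"])
  finally show ?thesis .
qed

subsection \<open>The null space\<close>

text \<open>This is the all-ones matrix of one factor, acting on coordinate \<open>i\<close>; on a
  clique it equals adjacency plus the identity.\<close>

definition J :: "nat \<Rightarrow> ((nat \<Rightarrow> int) \<Rightarrow> real) \<Rightarrow> (nat \<Rightarrow> int) \<Rightarrow> real" where
  "J i X f = (\<Sum>a\<in>{0..<int (n i)}. X (f(i := a)))"

text \<open>The adjacency operator of the factor $K_{d,d}$.\<close>

definition K :: "((nat \<Rightarrow> int) \<Rightarrow> real) \<Rightarrow> (nat \<Rightarrow> int) \<Rightarrow> real" where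
  "K X f = (\<Sum>a | a \<in> {0..<int (n r)} \<and> odd (f r - a). X (f(r := a)))"

text \<open>Differences appear below as \<open>X f + (- 1) * Y f\<close> and the like, so that this
  rule together with \<open>J_scale\<close> rewrites them.\<close>

lemma J_lin: "J i (\<lambda>f. X f + \<alpha> * Y f) f = J i X f + \<alpha> * J i Y f"
  by (simp add: J_def sum.distrib sum_distrib_left)

lemma K_lin: "K (\<lambda>f. X f + \<alpha> * Y f) f = K X f + \<alpha> * K Y f"
  by (simp add: K_def sum.distrib sum_distrib_left)

lemma J_scale: "J i (\<lambda>f. \<alpha> * Y f) f = \<alpha> * J i Y f"
  by (simp add: J_def sum_distrib_left)

lemma K_scale: "K (\<lambda>f. \<alpha> * Y f) f = \<alpha> * K Y f"
  by (simp add: K_def sum_distrib_left)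

lemma J_sum: "J i (\<lambda>f. \<Sum>j\<in>I. X j f) f = (\<Sum>j\<in>I. J i (X j) f)"
  unfolding J_def by (rule sum.swap)

lemma K_sum: "K (\<lambda>f. \<Sum>j\<in>I. X j f) f = (\<Sum>j\<in>I. K (X j) f)"
  unfolding K_def by (rule sum.swap)

lemma J_cong: "f \<in> F \<Longrightarrow> i \<le> r \<Longrightarrow> (\<And>g. g \<in> F \<Longrightarrow> X g = Y g) \<Longrightarrow> J i X f = J i Y f"
  unfolding J_def using upd_F by (intro sum.cong) auto

lemma K_cong: "f \<in> F \<Longrightarrow> (\<And>g. g \<in> F \<Longrightarrow> X g = Y g) \<Longrightarrow> K X f = K Y f"
  unfolding K_def using upd_F[of f r] by (intro sum.cong) auto

lemma J_commute: "i \<noteq> j \<Longrightarrow> J i (J j X) f = J j (J i X) f"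
  unfolding J_def by (subst sum.swap) (simp add: fun_upd_twist)

lemma J_J: "J i (J i X) f = real (n i) * J i X f"
  by (simp add: J_def)

lemma J_K_commute: "i \<noteq> r \<Longrightarrow> J i (K X) f = K (J i X) f"
  unfolding J_def K_def by (subst sum.swap) (simp add: fun_upd_twist)

text \<open>Each step of the induction adds two consecutive integers, exactly one of which differs
  from \<open>x\<close> in parity.\<close>

lemma card_parity_class: "card {a. a \<in> {0..<2 * int m} \<and> odd (x - a)} = m"
proof (induction m)
  case (Suc m)
  have "{a. a \<in> {0..<2 * int (Suc m)} \<and> odd (x - a)}
    = insert (if odd (x - 2 * int m) then 2 * int m else 2 * int m + 1)
        {a. a \<in> {0..<2 * int m} \<and> odd (x - a)}" (is "?A = insert ?b ?B")
  proof (rule equalityI; rule subsetI)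
    fix a assume a: "a \<in> ?A"
    then consider "a < 2 * int m" | "a = 2 * int m" | "a = 2 * int m + 1" by force
    then show "a \<in> insert ?b ?B" using a by cases auto
  qed (auto split: if_splits)
  moreover have "finite ?B" by (rule finite_subset[of _ "{0..<2 * int m}"]) auto
  ultimately show ?case using Suc by auto
qed simp

text \<open>The eigenvalues of $K_{d,d}$ are \<open>d\<close>, 0 and \<open>- d\<close>. Concretely,
  two steps lead back to the own part with \<open>d\<close> choices for the midpoint, so the square
  of \<open>K\<close> is \<open>d\<close> times the sum \<open>L\<close> over that part, and
  \<open>K\<close> after \<open>L\<close> is \<open>d\<close> times \<open>K\<close>.\<close>

lemma K_K_K: "K (K (K X)) f = real d ^ 2 * K X f"
proof -
  define L where "L Y f = (\<Sum>b | b \<in> {0..<int (n r)} \<and> even (f r - b). Y (f(r := b)))"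
    for Y :: "(nat \<Rightarrow> int) \<Rightarrow> real" and f
  have cd: "card {a. a \<in> {0..<int (n r)} \<and> odd (f r - a)} = d" for f :: "nat \<Rightarrow> int"
    using card_parity_class[of d "f r"] by (simp add: n_last)
  have KK: "K (K X) f = real d * L X f" for f X
  proof -
    have "K (K X) f = (\<Sum>a | a \<in> {0..<int (n r)} \<and> odd (f r - a). L X f)"
      unfolding K_def L_def by (intro sum.cong refl) (auto intro!: sum.cong)
    then show ?thesis by (simp only: sum_constant cd)
  qed
  have KL: "K (L X) f = real d * K X f"
  proof -
    have "K (L X) f = (\<Sum>a | a \<in> {0..<int (n r)} \<and> odd (f r - a). K X f)"
      unfolding K_def L_def by (intro sum.cong refl) (auto intro!: sum.cong)
    then show ?thesis by (simp only: sum_constant cd)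
  qed
  have "K (K (K X)) f = K (\<lambda>f. real d * L X f) f"
    using KK by (metis ext)
  then show ?thesis by (simp add: K_scale KL power2_eq_square)
qed

text \<open>
  The operators \<open>J i\<close> commute and satisfy \<open>J i (J i X) = n i * J i X\<close>, so their joint eigenvalues are
  subset sums of the \<open>n i\<close>.
\<close>

lemma sum_J_no_eigenvalue:
  assumes "finite I" "I \<subseteq> {..<r}"
    and "\<And>B. B \<subseteq> I \<Longrightarrow> real (\<Sum>i\<in>B. n i) \<noteq> \<alpha>"
    and "\<And>f. f \<in> F \<Longrightarrow> (\<Sum>i\<in>I. J i z f) = \<alpha> * z f"
    and "f \<in> F"
  shows "z f = 0"
  using assms
proof (induction I arbitrary: \<alpha> z f rule: finite_induct)
  case empty
  from empty.prems(2)[of "{}"] empty.prems(3)[OF empty.prems(4)] show ?case by auto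
next
  case (insert i I)
  have i: "i \<le> r" using insert.prems(1) by auto
  \<comment> \<open>On the image of \<open>J i\<close> the operator \<open>J i\<close> is
    multiplication by \<open>n i\<close>, so \<open>J i z\<close> solves the problem for
    \<open>I\<close> with \<open>n i\<close> taken off the eigenvalue; a subset \<open>B\<close> of
    \<open>I\<close> corresponds to \<open>insert i B\<close>.\<close>
  have Jz: "J i z f = 0" if "f \<in> F" for f
  proof (rule insert.IH[OF _ _ _ that])
    show "I \<subseteq> {..<r}" using insert.prems(1) by auto
    show "real (\<Sum>i\<in>B. n i) \<noteq> \<alpha> - real (n i)" if "B \<subseteq> I" for B
    proof -
      have "finite B" "i \<notin> B" using that insert.hyps finite_subset by auto
      moreover have "insert i B \<subseteq> insert i I" using that by blast
      ultimately show ?thesis using insert.prems(2)[of "insert i B"] by auto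
    qed
    show "(\<Sum>j\<in>I. J j (J i z) f) = (\<alpha> - real (n i)) * J i z f" if f: "f \<in> F" for f
    proof -
      have "(\<Sum>j\<in>I. J j (J i z) f) = (\<Sum>j\<in>I. J i (J j z) f)"
        using insert.hyps by (intro sum.cong refl J_commute) auto
      also have "\<dots> = J i (\<lambda>f. \<Sum>j\<in>I. J j z f) f" by (simp add: J_sum)
      also have "\<dots> = J i (\<lambda>f. \<alpha> * z f + (- 1) * J i z f) f"
        using f i
      proof (rule J_cong)
        fix g assume "g \<in> F"
        from insert.prems(3)[OF this] show "(\<Sum>j\<in>I. J j z g) = \<alpha> * z g + (- 1) * J i z g"
          using insert.hyps by simp
      qed
      also have "\<dots> = (\<alpha> - real (n i)) * J i z f"
        by (simp only: J_lin J_scale J_J) (simp add: algebra_simps)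
      finally show ?thesis .
    qed
  qed
  \<comment> \<open>Now that \<open>J i z\<close> vanishes, \<open>z\<close> itself is an
    eigenvector for \<open>I\<close> with the same \<open>\<alpha>\<close>.\<close>
  show ?case
  proof (rule insert.IH[OF _ _ _ insert.prems(4)])
    show "I \<subseteq> {..<r}" using insert.prems(1) by auto
    show "real (\<Sum>i\<in>B. n i) \<noteq> \<alpha>" if "B \<subseteq> I" for B
      using insert.prems(2)[of B] that by auto
    show "(\<Sum>j\<in>I. J j z f) = \<alpha> * z f" if "f \<in> F" for f
      using insert.prems(3)[OF that] insert.hyps Jz[OF that] by simp
  qed
qed

text \<open>The hypothesis says that \<open>X\<close> is in the kernel. As \<open>K\<close> commutes
  with the \<open>J i\<close>, on the part of \<open>X\<close> where \<open>K\<close> acts as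
  \<open>t\<close> the sum of the \<open>J i\<close> acts as \<open>r - t\<close>. For
  \<open>t = d\<close> this is negative and for \<open>t = 0\<close> it is \<open>r\<close>, neither
  of them a subset sum; for \<open>t = - d\<close> it is the sum of all \<open>n i\<close>, which
  forces every \<open>J i\<close> to act as \<open>n i\<close>.\<close>

lemma product_kernel:
  assumes X: "\<And>f. f \<in> F \<Longrightarrow> (\<Sum>i<r. J i X f) = real r * X f - K X f"
  shows "\<And>f. f \<in> F \<Longrightarrow> K X f = - real d * X f"
    and "\<And>f i. f \<in> F \<Longrightarrow> i < r \<Longrightarrow> J i X f = real (n i) * X f"
proof -
  have step: "(\<Sum>i<r. J i (K Y) f) = real r * K Y f - K (K Y) f"
    if "\<And>f. f \<in> F \<Longrightarrow> (\<Sum>i<r. J i Y f) = real r * Y f - K Y f" "f \<in> F" for Y f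
  proof -
    have "(\<Sum>i<r. J i (K Y) f) = (\<Sum>i<r. K (J i Y) f)"
      by (intro sum.cong refl J_K_commute) auto
    also have "\<dots> = K (\<lambda>f. \<Sum>i<r. J i Y f) f" by (simp add: K_sum)
    also have "\<dots> = K (\<lambda>f. real r * Y f + (- 1) * K Y f) f"
      using that by (intro K_cong) auto
    also have "\<dots> = real r * K Y f - K (K Y) f"
      by (simp only: K_lin K_scale)
    finally show ?thesis .
  qed
  have KX: "(\<Sum>i<r. J i (K X) f) = real r * K X f - K (K X) f" if "f \<in> F" for f
    using X that by (rule step)
  have KKX: "(\<Sum>i<r. J i (K (K X)) f) = real r * K (K X) f - K (K (K X)) f" if "f \<in> F" for f
    using KX that by (rule step)
  have sum_J_lin: "(\<Sum>i<r. J i (\<lambda>f. Y f + \<alpha> * Z f) f) = (\<Sum>i<r. J i Y f) + \<alpha> * (\<Sum>i<r. J i Z f)"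
    for Y Z f \<alpha> by (simp add: J_lin sum.distrib sum_distrib_left)
  \<comment> \<open>\<open>K\<close> is annihilated by \<open>t * (t - d) * (t + d)\<close>; the components of \<open>X\<close> for the roots \<open>d\<close> and
    \<open>0\<close> vanish.\<close>
  have plus: "K (K X) f + real d * K X f = 0" if "f \<in> F" for f
  proof (rule sum_J_no_eigenvalue[where I = "{..<r}" and z = "\<lambda>f. K (K X) f + real d * K X f"
        and \<alpha> = "real r - real d"])
    show "real (\<Sum>i\<in>B. n i) \<noteq> real r - real d" for B
    proof -
      have "real r - real d < 0" using d_gt_r by simp
      then show ?thesis by (metis not_less of_nat_0_le_iff)
    qed
    show "(\<Sum>i<r. J i (\<lambda>f. K (K X) f + real d * K X f) f)
      = (real r - real d) * (K (K X) f + real d * K X f)" if "f \<in> F" for f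
      using KX[OF that] KKX[OF that]
      by (simp only: sum_J_lin K_K_K) (simp add: algebra_simps power2_eq_square)
  qed (use that in auto)
  have zero: "K (K X) f + (- (real d ^ 2)) * X f = 0" if "f \<in> F" for f
  proof (rule sum_J_no_eigenvalue[where I = "{..<r}" and \<alpha> = "real r"
        and z = "\<lambda>f. K (K X) f + (- (real d ^ 2)) * X f"])
    show "real (\<Sum>i\<in>B. n i) \<noteq> real r" if "B \<subseteq> {..<r}" for B
    proof (cases "B = {}")
      case False
      then obtain i where i: "i \<in> B" by auto
      have "finite B" using that finite_subset by auto
      then have "n i \<le> (\<Sum>i\<in>B. n i)" using i by (simp add: member_le_sum)
      moreover have "r < n i" using n_gt[of i] i that by auto
      ultimately have "r < (\<Sum>i\<in>B. n i)" by linarith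
      then show ?thesis by linarith
    qed (use r_pos in auto)
    show "(\<Sum>i<r. J i (\<lambda>f. K (K X) f + (- (real d ^ 2)) * X f) f)
      = real r * (K (K X) f + (- (real d ^ 2)) * X f)" if "f \<in> F" for f
      using X[OF that] KKX[OF that]
      by (simp only: sum_J_lin K_K_K) (simp add: algebra_simps power2_eq_square)
  qed (use that in auto)
  show K: "K X f = - real d * X f" if "f \<in> F" for f
  proof -
    \<comment> \<open>Subtracting \<open>zero\<close> from \<open>plus\<close> removes the square of
      \<open>K\<close> and leaves this product.\<close>
    have "real d * (K X f + real d * X f) = 0"
      using plus[OF that] zero[OF that] by (simp add: algebra_simps power2_eq_square)
    then show ?thesis using d_gt_r by (auto simp: eq_neg_iff_add_eq_0)
  qed
  show "J i X f = real (n i) * X f" if "f \<in> F" "i < r" for f i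
  proof -
    \<comment> \<open>This difference is killed by \<open>J i\<close>, so on it the remaining
      operators alone must sum to \<open>d + r\<close>; without \<open>n i\<close> no subset reaches
      that total.\<close>
    have "J i X f + (- real (n i)) * X f = 0"
    proof (rule sum_J_no_eigenvalue[where I = "{..<r} - {i}" and \<alpha> = "real (d + r)"
          and z = "\<lambda>f. J i X f + (- real (n i)) * X f"])
      show "real (\<Sum>j\<in>B. n j) \<noteq> real (d + r)" if "B \<subseteq> {..<r} - {i}" for B
      proof -
        have "(\<Sum>j\<in>B. n j) < (\<Sum>j<r. n j)"
          using that \<open>i < r\<close> n_gt[of i]
          by (intro sum_strict_mono2[of _ _ i]) auto
        then show ?thesis by (simp only: sum_n)
      qed
      show "(\<Sum>j\<in>{..<r} - {i}. J j (\<lambda>f. J i X f + (- real (n i)) * X f) f)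
        = real (d + r) * (J i X f + (- real (n i)) * X f)" if f: "f \<in> F" for f
      proof -
        let ?z = "\<lambda>f. J i X f + (- real (n i)) * X f"
        have "J i ?z f = 0" by (simp only: J_lin J_J)
        then have "(\<Sum>j\<in>{..<r} - {i}. J j ?z f) = (\<Sum>j<r. J j ?z f)"
          using \<open>i < r\<close> by (simp add: sum.remove[of "{..<r}" i])
        also have "\<dots> = (\<Sum>j<r. J j (J i X) f) - real (n i) * (\<Sum>j<r. J j X f)"
          by (simp only: sum_J_lin)
        also have "(\<Sum>j<r. J j (J i X) f) = (\<Sum>j<r. J i (J j X) f)"
          by (intro sum.cong refl) (metis J_commute)
        also have "\<dots> = J i (\<lambda>f. \<Sum>j<r. J j X f) f" by (simp only: J_sum)
        also have "\<dots> = J i (\<lambda>f. real (d + r) * X f) f"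
          using f \<open>i < r\<close> X K by (intro J_cong) (auto simp: algebra_simps)
        also have "(\<Sum>j<r. J j X f) = real (d + r) * X f"
          using X[OF f] K[OF f] by (simp add: algebra_simps)
        finally show ?thesis by (simp only: J_scale) (simp add: algebra_simps)
      qed
    qed (use that in auto)
    then show ?thesis by simp
  qed
qed

section \<open>From functions on coordinates to vectors on the vertices\<close>

definition dec :: "(nat \<Rightarrow> int) \<Rightarrow> 'a" where
  "dec f = inv_into V c f"

lemma dec_V: "f \<in> F \<Longrightarrow> dec f \<in> V"
  using bij_c by (simp add: dec_def bij_betw_def inv_into_into)

lemma c_dec: "f \<in> F \<Longrightarrow> c (dec f) = f"
  using bij_c by (simp add: dec_def bij_betw_def f_inv_into_f)

lemma dec_c: "v \<in> V \<Longrightarrow> dec (c v) = v"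
  using bij_c by (simp add: dec_def bij_betw_def)

lemma finite_V: "finite V"
  using bij_c finite_F bij_betw_finite by blast

text \<open>Each \<open>J i\<close> also counts the vertex itself, once for each of the
  \<open>r\<close> cliques, which accounts for the subtracted term.\<close>

lemma adjacency_sum:
  assumes "u \<in> V"
  shows "(\<Sum>v\<in>V. adjacency_matrix G u v * x v)
    = (\<Sum>i<r. J i (x \<circ> dec) (c u)) - real r * (x \<circ> dec) (c u) + K (x \<circ> dec) (c u)"
proof -
  let ?f = "c u" and ?X = "x \<circ> dec"
  have f: "?f \<in> F" using assms by (rule c_F)
  have "(\<Sum>v\<in>V. adjacency_matrix G u v * x v)
      = (\<Sum>v\<in>V. (if nbr ?f (c v) then ?X (c v) else 0))"
    using assms by (intro sum.cong) (auto simp: adjacency_matrix_def G_def dec_c)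
  also have "\<dots> = (\<Sum>g\<in>F. if nbr ?f g then ?X g else 0)"
    by (rule sum.reindex_bij_betw[OF bij_c])
  also have "\<dots> = (\<Sum>g | g \<in> F \<and> nbr ?f g. ?X g)"
    by (rule sum.inter_filter[OF finite_F, symmetric])
  also have "\<dots> = (\<Sum>i\<le>r. \<Sum>a | a \<in> {0..<int (n i)} \<and> R i (?f i) a. ?X (?f(i := a)))"
    using f by (rule sum_nbr)
  also have "{..r} = insert r {..<r}" by auto
  also have "(\<Sum>i\<in>insert r {..<r}. \<Sum>a | a \<in> {0..<int (n i)} \<and> R i (?f i) a. ?X (?f(i := a)))
    = K ?X ?f + (\<Sum>i<r. \<Sum>a | a \<in> {0..<int (n i)} \<and> R i (?f i) a. ?X (?f(i := a)))"
    by (simp add: K_def R_def)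
  also have "(\<Sum>i<r. \<Sum>a | a \<in> {0..<int (n i)} \<and> R i (?f i) a. ?X (?f(i := a)))
    = (\<Sum>i<r. J i ?X ?f - ?X ?f)"
  proof (rule sum.cong[OF refl])
    fix i assume i: "i \<in> {..<r}"
    then have "{a. a \<in> {0..<int (n i)} \<and> R i (?f i) a} = {0..<int (n i)} - {?f i}"
      by (auto simp: R_def)
    moreover have "?f i \<in> {0..<int (n i)}" using i f by (intro F_range) auto
    ultimately show "(\<Sum>a | a \<in> {0..<int (n i)} \<and> R i (?f i) a. ?X (?f(i := a)))
        = J i ?X ?f - ?X ?f"
      by (simp add: J_def sum_diff1)
  qed
  finally show ?thesis by (simp add: sum_subtractf del: o_apply)
qed

text \<open>It is constant in each clique coordinate, where the adjacency eigenvalue is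
  \<open>n i - 1\<close>, and is the sign vector of $K_{d,d}$, with eigenvalue \<open>- d\<close>;
  these add up to 0. Off \<open>V\<close> it is 0 because \<open>null_space\<close> demands
  it.\<close>

definition kernel_vector :: "'a \<Rightarrow> real" where
  "kernel_vector v = (if v \<in> V then if even (c v r) then 1 else - 1 else 0)"

lemma null_space_iff:
  "x \<in> null_space G \<longleftrightarrow> (\<forall>v. v \<notin> V \<longrightarrow> x v = 0) \<and>
    (\<forall>f\<in>F. (\<Sum>i<r. J i (x \<circ> dec) f) = real r * (x \<circ> dec) f - K (x \<circ> dec) f)"
proof -
  have "(\<forall>u\<in>V. (\<Sum>v\<in>V. adjacency_matrix G u v * x v) = 0) \<longleftrightarrow>
    (\<forall>u\<in>V. (\<Sum>i<r. J i (x \<circ> dec) (c u)) = real r * (x \<circ> dec) (c u) - K (x \<circ> dec) (c u))"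
    by (intro ball_cong refl) (simp only: adjacency_sum, rule iffI; linarith)
  also have "\<dots> \<longleftrightarrow>
    (\<forall>f\<in>F. (\<Sum>i<r. J i (x \<circ> dec) f) = real r * (x \<circ> dec) f - K (x \<circ> dec) f)"
    by (simp only: bij_betw_imp_surj_on[OF bij_c, symmetric] ball_simps)
  finally show ?thesis by (simp add: null_space_def G_def)
qed

lemma null_space_eigen:
  assumes "x \<in> null_space G" "f \<in> F"
  shows "K (x \<circ> dec) f = - real d * x (dec f)"
    and "i < r \<Longrightarrow> J i (x \<circ> dec) f = real (n i) * x (dec f)"
proof -
  have X: "(\<Sum>i<r. J i (x \<circ> dec) f) = real r * (x \<circ> dec) f - K (x \<circ> dec) f"
    if "f \<in> F" for f
    using assms(1) that null_space_iff by blast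
  have "K (x \<circ> dec) f = - real d * (x \<circ> dec) f"
    using X assms(2) by (rule product_kernel(1))
  then show "K (x \<circ> dec) f = - real d * x (dec f)" by (simp only: o_apply)
  assume "i < r"
  with X assms(2) have "J i (x \<circ> dec) f = real (n i) * (x \<circ> dec) f"
    by (rule product_kernel(2))
  then show "J i (x \<circ> dec) f = real (n i) * x (dec f)" by (simp only: o_apply)
qed

text \<open>The sum \<open>J i\<close> does not see the value of coordinate \<open>i\<close>, yet on
  the kernel it is \<open>n i\<close> times the vector, so the vector does not depend on that
  coordinate.\<close>

lemma null_space_upd:
  assumes x: "x \<in> null_space G" and f: "f \<in> F" and i: "i < r"
    and a: "a \<in> {0..<int (n i)}"
  shows "x (dec (f(i := a))) = x (dec f)"
proof -
  have fa: "f(i := a) \<in> F" using f i a by (intro upd_F) auto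
  have "J i (x \<circ> dec) (f(i := a)) = J i (x \<circ> dec) f" by (simp add: J_def)
  then have "real (n i) * x (dec (f(i := a))) = real (n i) * x (dec f)"
    using null_space_eigen(2)[OF x f i] null_space_eigen(2)[OF x fa i] by linarith
  then show ?thesis using n_gt[OF i] by simp
qed

text \<open>Two points in the same part of $K_{d,d}$ have the same neighbours there, so
  \<open>K\<close> takes the same value at both; on the kernel it is \<open>- d\<close> times the
  vector.\<close>

lemma null_space_upd_even:
  assumes x: "x \<in> null_space G" and f: "f \<in> F"
    and a: "a \<in> {0..<int (n r)}" "even (a - f r)"
  shows "x (dec (f(r := a))) = x (dec f)"
proof -
  have fa: "f(r := a) \<in> F" using f a by (intro upd_F) auto
  have "{b. b \<in> {0..<int (n r)} \<and> odd (a - b)} = {b. b \<in> {0..<int (n r)} \<and> odd (f r - b)}"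
    using a(2) by auto
  then have "K (x \<circ> dec) (f(r := a)) = K (x \<circ> dec) f" by (simp add: K_def)
  then have "real d * x (dec (f(r := a))) = real d * x (dec f)"
    using null_space_eigen(1)[OF x f] null_space_eigen(1)[OF x fa] by linarith
  then show ?thesis using d_gt_r by simp
qed

text \<open>At the new point \<open>K\<close> sums over the part containing \<open>f r\<close>, on
  which the vector is constant by \<open>null_space_upd_even\<close>; comparing \<open>d\<close>
  equal terms with the eigenvalue \<open>- d\<close> gives the sign.\<close>

lemma null_space_upd_odd:
  assumes x: "x \<in> null_space G" and f: "f \<in> F"
    and a: "a \<in> {0..<int (n r)}" "odd (a - f r)"
  shows "x (dec (f(r := a))) = - x (dec f)"
proof -
  have fa: "f(r := a) \<in> F" using f a by (intro upd_F) auto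
  have "x (dec (f(r := b))) = x (dec f)" if "b \<in> {0..<int (n r)}" "odd (a - b)" for b
  proof (rule null_space_upd_even[OF x f that(1)])
    have "b - f r = (a - f r) - (a - b)" by simp
    then show "even (b - f r)" using a(2) that(2) by (metis odd_even_add even_diff)
  qed
  then have "K (x \<circ> dec) (f(r := a)) = (\<Sum>b | b \<in> {0..<int (n r)} \<and> odd (a - b). x (dec f))"
    unfolding K_def by (intro sum.cong) auto
  also have "\<dots> = real d * x (dec f)"
    using card_parity_class[of d a] by (simp only: sum_constant n_last of_nat_mult of_nat_numeral)
  finally have "real d * (x (dec (f(r := a))) + x (dec f)) = 0"
    using null_space_eigen(1)[OF x fa] by (simp add: algebra_simps)
  then show ?thesis using d_gt_r by (simp add: eq_neg_iff_add_eq_0)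
qed

text \<open>The common reference point: the scalar of a kernel vector is read off at it, and it
  becomes the neutral element of the group.\<close>

definition base :: "nat \<Rightarrow> int" where
  "base = (\<lambda>i\<in>{..r}. 0)"

lemma base_F: "base \<in> F"
proof (rule PiE_I)
  show "base i \<in> {0..<int (n i)}" if "i \<in> {..r}" for i
    using n_ge_2[of i] that by (simp add: base_def)
qed (simp add: base_def)

lemma null_space_eq: "null_space G = fun_space.span {kernel_vector}"
proof (intro equalityI subsetI)
  fix x assume x: "x \<in> null_space G"
  have at_base: "x (dec f) = (if even (f r) then 1 else - 1) * x (dec base)" if f: "f \<in> F" for f
  proof -
    \<comment> \<open>A path from \<open>f\<close> towards \<open>base\<close>: \<open>h k\<close>
      has the first \<open>k\<close> coordinates cleared, so \<open>h r\<close> differs from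
      \<open>base\<close> in the last coordinate at most.\<close>
    define h where "h k = (\<lambda>j. if j < k then 0 else f j)" for k
    have hF: "h k \<in> F" if "k \<le> r" for k
      using f that F_range[OF f] n_gt_0 by (auto simp: h_def PiE_iff extensional_def Ball_def)
    have "x (dec (h k)) = x (dec f)" if "k \<le> r" for k
      using that
    proof (induction k)
      case 0
      then show ?case by (simp add: h_def)
    next
      case (Suc k)
      have "h (Suc k) = (h k)(k := 0)" by (auto simp: h_def fun_eq_iff)
      then have "x (dec (h (Suc k))) = x (dec (h k))"
        using Suc.prems n_gt_0[of k] by (simp only:) (rule null_space_upd[OF x hF], auto)
      then show ?case using Suc by simp
    qed
    from this[of r] have hr: "x (dec (h r)) = x (dec f)" by simp
    have hbase: "base = (h r)(r := 0)"
      using f by (auto simp: h_def base_def fun_eq_iff PiE_iff extensional_def)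
    show ?thesis
    proof (cases "even (f r)")
      case True
      \<comment> \<open>An even last coordinate is moved to 0 through an odd value \<open>b\<close>,
        with two changes of sign.\<close>
      obtain b where b: "b \<in> {0..<int (n r)}" "odd b"
        using n_ge_2[of r] by (intro that[of 1]) auto
      have bF: "(h r)(r := b) \<in> F" using hF b by (intro upd_F) auto
      have "x (dec ((h r)(r := b))) = - x (dec (h r))"
        using True b by (intro null_space_upd_odd[OF x hF]) (auto simp: h_def)
      moreover have "x (dec (((h r)(r := b))(r := 0))) = - x (dec ((h r)(r := b)))"
        using b n_ge_2[of r] by (intro null_space_upd_odd[OF x bF]) auto
      ultimately show ?thesis using True hr hbase by simp
    next
      case False
      then have "x (dec ((h r)(r := 0))) = - x (dec (h r))"
        using n_ge_2[of r] by (intro null_space_upd_odd[OF x hF]) (auto simp: h_def)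
      then show ?thesis using False hr hbase by simp
    qed
  qed
  have "x v = x (dec base) * kernel_vector v" for v
  proof (cases "v \<in> V")
    case True
    then show ?thesis using at_base[OF c_F[OF True]] by (simp add: dec_c kernel_vector_def)
  next
    case False
    then show ?thesis using x null_space_iff by (auto simp: kernel_vector_def)
  qed
  then show "x \<in> fun_space.span {kernel_vector}"
    unfolding fun_space.span_singleton by blast
next
  fix x assume "x \<in> fun_space.span {kernel_vector}"
  moreover have "kernel_vector \<in> null_space G"
  proof -
    let ?X = "kernel_vector \<circ> dec"
    have X: "?X f = (if even (f r) then 1 else - 1)" if "f \<in> F" for f
      using that by (simp add: kernel_vector_def c_dec dec_V)
    \<comment> \<open>By \<open>sum_n\<close> the \<open>J i\<close> give the factor
      \<open>d + r\<close>, which is \<open>r\<close> minus the factor \<open>- d\<close> of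
      \<open>K\<close>.\<close>
    have "(\<Sum>i<r. J i ?X f) = real r * ?X f - K ?X f" if f: "f \<in> F" for f
    proof -
      have "J i ?X f = real (n i) * ?X f" if "i < r" for i
      proof -
        have "J i ?X f = (\<Sum>a\<in>{0..<int (n i)}. ?X f)"
          unfolding J_def using f that X upd_F[OF f, of i] by (intro sum.cong) auto
        then show ?thesis by simp
      qed
      then have "(\<Sum>i<r. J i ?X f) = real (d + r) * ?X f"
        by (simp add: sum_distrib_right flip: sum_n)
      moreover have "K ?X f = - real d * ?X f"
      proof -
        have "K ?X f = (\<Sum>a | a \<in> {0..<int (n r)} \<and> odd (f r - a). - ?X f)"
          unfolding K_def using f X upd_F[OF f, of r] by (intro sum.cong) auto
        then show ?thesis
          using card_parity_class[of d "f r"] by (simp only: sum_constant n_last) (simp add: n_last)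
      qed
      ultimately show ?thesis by (simp add: algebra_simps)
    qed
    then show ?thesis by (auto simp: null_space_iff kernel_vector_def)
  qed
  ultimately show "x \<in> null_space G"
    using fun_space.span_minimal[OF _ subspace_null_space, of "{kernel_vector}" G] by auto
qed

subsection \<open>The Cayley structure\<close>

text \<open>In terms of values alone, adjacency is visibly symmetric and can be compared under
  translations; functions in \<open>F\<close> are extensional, so agreement outside
  \<open>{..r}\<close> is automatic.\<close>

lemma nbr_iff:
  assumes "f \<in> F" "g \<in> F"
  shows "nbr f g \<longleftrightarrow> (\<exists>i\<le>r. R i (f i) (g i) \<and> (\<forall>j\<le>r. j \<noteq> i \<longrightarrow> g j = f j))"
proof
  assume "nbr f g"
  then obtain i a where "i \<le> r" "R i (f i) a" "g = f(i := a)" unfolding nbr_def by blast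
  then show "\<exists>i\<le>r. R i (f i) (g i) \<and> (\<forall>j\<le>r. j \<noteq> i \<longrightarrow> g j = f j)"
    by (intro exI[of _ i]) simp
next
  assume "\<exists>i\<le>r. R i (f i) (g i) \<and> (\<forall>j\<le>r. j \<noteq> i \<longrightarrow> g j = f j)"
  then obtain i where i: "i \<le> r" "R i (f i) (g i)" "\<And>j. j \<le> r \<Longrightarrow> j \<noteq> i \<Longrightarrow> g j = f j" by blast
  have "g = f(i := g i)"
  proof
    fix j show "g j = (f(i := g i)) j"
      using i assms by (cases "j \<le> r") (auto simp: PiE_iff extensional_def)
  qed
  then show "nbr f g" unfolding nbr_def using i F_range[OF assms(2)] by blast
qed

lemma nbr_sym: "f \<in> F \<Longrightarrow> g \<in> F \<Longrightarrow> nbr f g \<Longrightarrow> nbr g f"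
  unfolding nbr_iff using R_sym by metis

lemma nbr_irrefl: "f \<in> F \<Longrightarrow> \<not> nbr f f"
  by (auto simp: nbr_iff R_irrefl)

text \<open>The product of the cyclic groups of orders \<open>n i\<close>, carried over to
  \<open>V\<close> along \<open>c\<close>. The restriction to \<open>{..r}\<close> keeps results in
  \<open>F\<close>.\<close>

definition \<Gamma> :: "'a monoid" where
  "\<Gamma> = \<lparr>carrier = V, monoid.mult = (\<lambda>u v. dec (\<lambda>i\<in>{..r}. (c u i + c v i) mod int (n i))),
     monoid.one = dec base\<rparr>"

lemma mod_F: "(\<lambda>i\<in>{..r}. h i mod int (n i)) \<in> F"
proof (rule PiE_I)
  show "(\<lambda>i\<in>{..r}. h i mod int (n i)) i \<in> {0..<int (n i)}" if "i \<in> {..r}" for i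
    using n_ge_2[of i] that by simp
qed simp

lemma carrier_\<Gamma>: "carrier \<Gamma> = V"
  by (simp add: \<Gamma>_def)

lemma one_\<Gamma>: "\<one>\<^bsub>\<Gamma>\<^esub> = dec base"
  by (simp add: \<Gamma>_def)

lemma mult_\<Gamma>: "u \<otimes>\<^bsub>\<Gamma>\<^esub> v = dec (\<lambda>i\<in>{..r}. (c u i + c v i) mod int (n i))"
  by (simp add: \<Gamma>_def)

lemma c_mult: "c (u \<otimes>\<^bsub>\<Gamma>\<^esub> v) = (\<lambda>i\<in>{..r}. (c u i + c v i) mod int (n i))"
  by (simp only: mult_\<Gamma> c_dec mod_F)

lemma restrict_mod_c: "v \<in> V \<Longrightarrow> (\<lambda>i\<in>{..r}. c v i mod int (n i)) = c v"
proof
  fix i assume "v \<in> V"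
  then show "(\<lambda>i\<in>{..r}. c v i mod int (n i)) i = c v i"
    using c_F[of v] by (cases "i \<le> r") (auto simp: PiE_iff extensional_def)
qed

lemma group_\<Gamma>: "group \<Gamma>"
proof (rule groupI)
  fix u v w
  have "(\<lambda>i\<in>{..r}. (c (u \<otimes>\<^bsub>\<Gamma>\<^esub> v) i + c w i) mod int (n i))
    = (\<lambda>i\<in>{..r}. (c u i + c (v \<otimes>\<^bsub>\<Gamma>\<^esub> w) i) mod int (n i))"
    by (rule restrict_ext) (simp add: c_mult mod_add_left_eq mod_add_right_eq add.assoc)
  then show "u \<otimes>\<^bsub>\<Gamma>\<^esub> v \<otimes>\<^bsub>\<Gamma>\<^esub> w = u \<otimes>\<^bsub>\<Gamma>\<^esub> (v \<otimes>\<^bsub>\<Gamma>\<^esub> w)"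
    by (simp only: mult_\<Gamma>[of "u \<otimes>\<^bsub>\<Gamma>\<^esub> v" w] mult_\<Gamma>[of u "v \<otimes>\<^bsub>\<Gamma>\<^esub> w"])
next
  fix u assume u: "u \<in> carrier \<Gamma>"
  have "(\<lambda>i\<in>{..r}. (c \<one>\<^bsub>\<Gamma>\<^esub> i + c u i) mod int (n i)) = (\<lambda>i\<in>{..r}. c u i mod int (n i))"
    by (rule restrict_ext) (simp add: one_\<Gamma> c_dec[OF base_F], simp add: base_def)
  then show "\<one>\<^bsub>\<Gamma>\<^esub> \<otimes>\<^bsub>\<Gamma>\<^esub> u = u"
    using u by (simp only: mult_\<Gamma> restrict_mod_c carrier_\<Gamma> dec_c)
  show "\<exists>v\<in>carrier \<Gamma>. v \<otimes>\<^bsub>\<Gamma>\<^esub> u = \<one>\<^bsub>\<Gamma>\<^esub>"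
  proof
    let ?v = "dec (\<lambda>i\<in>{..r}. (- c u i) mod int (n i))"
    show "?v \<in> carrier \<Gamma>" by (simp only: carrier_\<Gamma> dec_V mod_F)
    have "(\<lambda>i\<in>{..r}. (c ?v i + c u i) mod int (n i)) = base"
      unfolding base_def
      by (rule restrict_ext) (simp only: c_dec mod_F, simp add: mod_add_left_eq)
    then show "?v \<otimes>\<^bsub>\<Gamma>\<^esub> u = \<one>\<^bsub>\<Gamma>\<^esub>" by (simp only: mult_\<Gamma> one_\<Gamma>)
  qed
qed (simp_all only: carrier_\<Gamma> one_\<Gamma> mult_\<Gamma> dec_V mod_F base_F)

text \<open>Adjacency depends only on the coordinate differences modulo \<open>n i\<close>: on a
  clique, on whether the difference is 0; on the last factor, on its parity, which reduction
  respects because \<open>n r\<close> is even. The connection set consists of the neighbours of the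
  neutral element.\<close>

lemma cayley_G: "cayley_graph G"
proof -
  interpret group \<Gamma> by (rule group_\<Gamma>)
  define S where "S = {s \<in> V. nbr base (c s)}"
  have diff: "inv\<^bsub>\<Gamma>\<^esub> u \<otimes>\<^bsub>\<Gamma>\<^esub> v \<in> S \<longleftrightarrow> nbr (c u) (c v)" if uv: "u \<in> V" "v \<in> V" for u v
  proof -
    define w where "w = dec (\<lambda>i\<in>{..r}. (c v i - c u i) mod int (n i))"
    have w: "w \<in> V" and cw: "c w = (\<lambda>i\<in>{..r}. (c v i - c u i) mod int (n i))"
      using mod_F[of "\<lambda>i. c v i - c u i"] by (simp_all add: w_def dec_V c_dec)
    have "(\<lambda>i\<in>{..r}. (c u i + c w i) mod int (n i)) = (\<lambda>i\<in>{..r}. c v i mod int (n i))"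
      by (rule restrict_ext) (simp add: cw mod_add_right_eq)
    then have "u \<otimes>\<^bsub>\<Gamma>\<^esub> w = v" using uv by (simp only: mult_\<Gamma> restrict_mod_c dec_c)
    then have "inv\<^bsub>\<Gamma>\<^esub> u \<otimes>\<^bsub>\<Gamma>\<^esub> v = w" using inv_solve_left[of w u v] uv w carrier_\<Gamma> by simp
    then have "inv\<^bsub>\<Gamma>\<^esub> u \<otimes>\<^bsub>\<Gamma>\<^esub> v \<in> S \<longleftrightarrow> nbr base (c w)" using w by (simp add: S_def)
    also have "\<dots> \<longleftrightarrow> nbr (c u) (c v)"
    proof -
      have zero: "c w i = base i \<longleftrightarrow> c v i = c u i" if "i \<le> r" for i
      proof -
        have "(c v i - c u i) mod int (n i) = 0 \<longleftrightarrow> c v i mod int (n i) = c u i mod int (n i)"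
          by (simp add: mod_eq_dvd_iff mod_eq_0_iff_dvd)
        then show ?thesis
          using that F_range[OF c_F[OF uv(1)], of i] F_range[OF c_F[OF uv(2)], of i]
          by (simp add: cw base_def)
      qed
      moreover have "R i (base i) (c w i) \<longleftrightarrow> R i (c u i) (c v i)" if "i \<le> r" for i
      proof (cases "i = r")
        case True
        have "even (int (n r))" by (simp add: n_last)
        then show ?thesis using True by (auto simp: R_def cw base_def dvd_mod_iff)
      next
        case False
        then show ?thesis using zero[OF that] by (auto simp: R_def)
      qed
      ultimately show ?thesis
        unfolding nbr_iff[OF base_F c_F[OF w]] nbr_iff[OF c_F[OF uv(1)] c_F[OF uv(2)]] by blast
    qed
    finally show ?thesis .
  qed
  have "S \<subseteq> carrier \<Gamma> - {\<one>\<^bsub>\<Gamma>\<^esub>}"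
    using nbr_irrefl[OF base_F] c_dec[OF base_F] by (auto simp: S_def carrier_\<Gamma> one_\<Gamma>)
  moreover have "inv\<^bsub>\<Gamma>\<^esub> s \<in> S" if "s \<in> S" for s
  proof -
    have s: "s \<in> V" "nbr base (c s)" using that by (auto simp: S_def)
    \<comment> \<open>Closure under inverses is symmetry of adjacency, read through
      \<open>diff\<close> for the pair of \<open>s\<close> and the neutral element.\<close>
    then have "nbr (c s) (c \<one>\<^bsub>\<Gamma>\<^esub>)" using nbr_sym base_F c_F by (simp add: one_\<Gamma> c_dec)
    then have "inv\<^bsub>\<Gamma>\<^esub> s \<otimes>\<^bsub>\<Gamma>\<^esub> \<one>\<^bsub>\<Gamma>\<^esub> \<in> S"
      using diff[of s "\<one>\<^bsub>\<Gamma>\<^esub>"] s one_closed by (simp add: carrier_\<Gamma>)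
    moreover have "s \<in> carrier \<Gamma>" using s by (simp add: carrier_\<Gamma>)
    ultimately show ?thesis by simp
  qed
  moreover have "G = Cay \<Gamma> S"
    using diff by (auto simp: G_def Cay_def carrier_\<Gamma>)
  ultimately show ?thesis
    unfolding cayley_graph_def using group_\<Gamma> finite_V
    by (intro exI[of _ \<Gamma>] exI[of _ S]) (simp add: carrier_\<Gamma>)
qed

section \<open>The number of vertices and the nut property\<close>

lemma card_V: "card V = (\<Prod>i\<le>r. n i)"
  using bij_betw_same_card[OF bij_c] by (simp add: card_PiE)

text \<open>It serves twice: for having at least two vertices, and for unbounded vertex counts at
  the end.\<close>

lemma n_le_card_V: "i \<le> r \<Longrightarrow> n i \<le> card V"
proof -
  assume i: "i \<le> r"
  have "0 < card V" using base_F dec_V finite_V card_gt_0_iff by blast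
  moreover have "n i dvd card V" using i by (simp add: card_V dvd_prodI)
  ultimately show ?thesis using dvd_imp_le by blast
qed

lemma nut_G: "nut_graph G"
proof -
  have base: "kernel_vector (dec base) = 1"
    using n_ge_2 by (simp add: kernel_vector_def dec_V c_dec base_F) (simp add: base_def)
  have "fun_space.dim (null_space G) = card {kernel_vector}"
    unfolding null_space_eq
  proof (rule fun_space.dim_span_eq_card_independent)
    have "kernel_vector \<noteq> 0"
    proof
      assume "kernel_vector = 0"
      then show False using base by simp
    qed
    then show "fun_space.independent {kernel_vector}" by (simp add: fun_space.dependent_single)
  qed
  moreover have "2 \<le> card V" using n_le_card_V[of r] n_ge_2[of r] by linarith
  moreover have "\<forall>v\<in>V. kernel_vector v \<noteq> 0" by (auto simp: kernel_vector_def)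
  moreover have "pverts G = V" by (simp add: G_def)
  ultimately show ?thesis
    unfolding nut_graph_def using null_space_eq pair_graph_cayley_graph[OF cayley_G] by auto
qed

subsection \<open>Arc and edge orbits\<close>

lemma transpose_mem: "a \<in> A \<Longrightarrow> b \<in> A \<Longrightarrow> x \<in> A \<Longrightarrow> transpose a b x \<in> A"
  by (simp add: transpose_def)

text \<open>One map takes \<open>a\<close> to \<open>a'\<close>, then a transposition corrects the
  image of \<open>b\<close> without moving \<open>a'\<close>. On a clique every permutation will do;
  on $K_{d,d}$ both maps must preserve the bipartition.\<close>

lemma factor_arc_transitive:
  assumes j: "j \<le> r"
    and mem: "a \<in> {0..<int (n j)}" "b \<in> {0..<int (n j)}" "a' \<in> {0..<int (n j)}" "b' \<in> {0..<int (n j)}"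
    and arcs: "R j a b" "R j a' b'"
  obtains \<sigma> where "inj_on \<sigma> {0..<int (n j)}" "\<sigma> ` {0..<int (n j)} \<subseteq> {0..<int (n j)}"
    "\<And>x y. x \<in> {0..<int (n j)} \<Longrightarrow> y \<in> {0..<int (n j)} \<Longrightarrow> R j (\<sigma> x) (\<sigma> y) \<longleftrightarrow> R j x y"
    "\<sigma> a = a'" "\<sigma> b = b'"
proof (cases "j = r")
  case False
  define \<tau> where "\<tau> = transpose a a'"
  define \<sigma> where "\<sigma> = transpose (\<tau> b) b' \<circ> \<tau>"
  have \<tau>: "\<tau> x \<in> {0..<int (n j)}" if "x \<in> {0..<int (n j)}" for x
    using that mem by (simp add: \<tau>_def transpose_def)
  have inj: "inj \<sigma>"
    unfolding \<sigma>_def \<tau>_def by (intro inj_compose) simp_all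
  show thesis
  proof
    show "inj_on \<sigma> {0..<int (n j)}" using inj by (rule inj_on_subset) simp
    show "\<sigma> ` {0..<int (n j)} \<subseteq> {0..<int (n j)}"
      unfolding \<sigma>_def comp_apply using \<tau> mem by (intro image_subsetI transpose_mem)
    show "R j (\<sigma> x) (\<sigma> y) \<longleftrightarrow> R j x y" for x y
      using inj False by (simp add: R_def inj_eq)
    show "\<sigma> a = a'" "\<sigma> b = b'"
      using arcs False by (auto simp: R_def \<sigma>_def \<tau>_def transpose_def)
  qed
next
  case True
  \<comment> \<open>Translation by \<open>a' - a\<close> shifts all parities alike, and since
    \<open>n r\<close> is even, reduction does not disturb this.\<close>
  define \<tau> where "\<tau> x = (x + (a' - a)) mod int (n r)" for x
  define \<sigma> where "\<sigma> = transpose (\<tau> b) b' \<circ> \<tau>"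
  have \<tau>: "\<tau> x \<in> {0..<int (n r)}" for x
    using n_gt_0[of r] by (simp add: \<tau>_def)
  have parity_\<tau>: "even (\<tau> x) \<longleftrightarrow> even (x + (a' - a))" for x
    by (simp add: \<tau>_def n_last dvd_mod_iff)
  have ab: "odd (a - b)" "odd (a' - b')" using arcs True by (simp_all add: R_def)
  have \<tau>a: "\<tau> a = a'" using mem True by (simp add: \<tau>_def)
  have parity_b: "even (\<tau> b) \<longleftrightarrow> even b'" using parity_\<tau>[of b] ab by auto
  \<comment> \<open>The points \<open>\<tau> b\<close> and \<open>b'\<close> have equal parity, so
    their transposition stays inside one part.\<close>
  have "even (transpose p q y) \<longleftrightarrow> even y" if "even p \<longleftrightarrow> even q" for p q y :: int
    using that by (simp add: transpose_def)
  from this[OF parity_b] have parity: "even (\<sigma> x) \<longleftrightarrow> even (x + (a' - a))" for x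
    by (simp only: \<sigma>_def comp_apply parity_\<tau>)
  have inj_\<tau>: "inj_on \<tau> {0..<int (n r)}"
  proof (rule inj_onI)
    fix x y assume xy: "x \<in> {0..<int (n r)}" "y \<in> {0..<int (n r)}" "\<tau> x = \<tau> y"
    then have "int (n r) dvd (x + (a' - a)) - (y + (a' - a))"
      unfolding \<tau>_def by (simp only: mod_eq_dvd_iff)
    then have "x mod int (n r) = y mod int (n r)" by (simp add: mod_eq_dvd_iff)
    then show "x = y" using xy by simp
  qed
  show thesis
  proof
    show "inj_on \<sigma> {0..<int (n j)}"
      unfolding \<sigma>_def True using inj_\<tau> by (rule comp_inj_on) simp
    show "\<sigma> ` {0..<int (n j)} \<subseteq> {0..<int (n j)}"
      unfolding \<sigma>_def comp_apply True using \<tau> mem True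
      by (intro image_subsetI transpose_mem) simp_all
    show "R j (\<sigma> x) (\<sigma> y) \<longleftrightarrow> R j x y" for x y
      using parity[of x] parity[of y] True by (auto simp: R_def)
    have "a' \<noteq> \<tau> b" "a' \<noteq> b'" using ab parity_b by auto
    then show "\<sigma> a = a'" by (simp add: \<sigma>_def \<tau>a transpose_def)
    show "\<sigma> b = b'" by (simp add: \<sigma>_def)
  qed
qed

section \<open>Directions of arcs and coordinatewise automorphisms\<close>

definition arc_dir :: "nat \<Rightarrow> 'a \<Rightarrow> 'a \<Rightarrow> bool" where
  "arc_dir i u v \<longleftrightarrow> u \<in> V \<and> v \<in> V \<and> R i (c u i) (c v i) \<and> (\<forall>j\<le>r. j \<noteq> i \<longrightarrow> c v j = c u j)"

lemma parcs_iff: "(u, v) \<in> parcs G \<longleftrightarrow> (\<exists>i\<le>r. arc_dir i u v)"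
  using nbr_iff[OF c_F c_F] by (auto simp: G_def arc_dir_def)

lemma arc_dir_exists:
  assumes "i \<le> r"
  obtains u v where "arc_dir i u v"
proof -
  have "1 \<in> {0..<int (n i)}" using n_ge_2[OF assms] by simp
  then have F: "base(i := 1) \<in> F" using base_F assms by (intro upd_F)
  then have "arc_dir i (dec base) (dec (base(i := 1)))"
    using assms dec_V[OF F] dec_V[OF base_F]
    unfolding arc_dir_def c_dec[OF F] c_dec[OF base_F] by (auto simp: R_def base_def)
  then show thesis by (rule that)
qed

text \<open>Applying an automorphism of each factor to its coordinate keeps the direction of every
  arc. Surjectivity comes from injectivity on a finite set.\<close>

lemma coordinatewise_aut:
  assumes inj: "\<And>j. j \<le> r \<Longrightarrow> inj_on (\<sigma> j) {0..<int (n j)}"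
    and maps: "\<And>j. j \<le> r \<Longrightarrow> \<sigma> j ` {0..<int (n j)} \<subseteq> {0..<int (n j)}"
    and R_iff: "\<And>j x y. j \<le> r \<Longrightarrow> x \<in> {0..<int (n j)} \<Longrightarrow> y \<in> {0..<int (n j)} \<Longrightarrow>
      R j (\<sigma> j x) (\<sigma> j y) \<longleftrightarrow> R j x y"
  shows "(\<lambda>v\<in>V. dec (\<lambda>j\<in>{..r}. \<sigma> j (c v j))) \<in> carrier (aut_group G)"
proof -
  define \<phi> where "\<phi> = (\<lambda>v\<in>V. dec (\<lambda>j\<in>{..r}. \<sigma> j (c v j)))"
  have range: "c v j \<in> {0..<int (n j)}" if "v \<in> V" "j \<le> r" for v j
    using F_range[OF c_F] that by blast
  have F: "(\<lambda>j\<in>{..r}. \<sigma> j (c v j)) \<in> F" if "v \<in> V" for v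
  proof (rule PiE_I)
    show "(\<lambda>j\<in>{..r}. \<sigma> j (c v j)) j \<in> {0..<int (n j)}" if "j \<in> {..r}" for j
      using maps[of j] range[OF \<open>v \<in> V\<close>, of j] that by (simp add: image_subset_iff)
  qed simp
  have c_\<phi>: "c (\<phi> v) j = \<sigma> j (c v j)" if "v \<in> V" "j \<le> r" for v j
    using F[OF that(1)] that by (simp add: \<phi>_def c_dec)
  have \<phi>_V: "\<phi> v \<in> V" if "v \<in> V" for v
    using F[OF that] that by (simp add: \<phi>_def dec_V)
  have coord_inj: "\<sigma> j (c u j) = \<sigma> j (c v j) \<longleftrightarrow> c u j = c v j"
    if "u \<in> V" "v \<in> V" "j \<le> r" for u v j
    using inj_on_eq_iff[OF inj range range] that by blast
  have "inj_on \<phi> V"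
  proof (rule inj_onI)
    fix u v assume uv: "u \<in> V" "v \<in> V" "\<phi> u = \<phi> v"
    have "c u j = c v j" if "j \<le> r" for j
      using coord_inj[OF uv(1,2) that] c_\<phi>[OF uv(1) that] c_\<phi>[OF uv(2) that] uv(3) by simp
    then have "c u = c v" using c_F[OF uv(1)] c_F[OF uv(2)] by (intro PiE_ext) auto
    then show "u = v" using uv by (simp add: c_inject)
  qed
  moreover from this have "\<phi> ` V = V"
    using \<phi>_V finite_V by (intro endo_inj_surj) auto
  ultimately have "\<phi> \<in> Bij V" by (auto simp: Bij_def bij_betw_def \<phi>_def)
  moreover have "arc_dir i (\<phi> u) (\<phi> v) \<longleftrightarrow> arc_dir i u v" if "u \<in> V" "v \<in> V" "i \<le> r" for u v i
    using that \<phi>_V c_\<phi> coord_inj R_iff[OF that(3) range[OF that(1,3)] range[OF that(2,3)]]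
    by (auto simp: arc_dir_def)
  then have "(\<phi> u, \<phi> v) \<in> parcs G \<longleftrightarrow> (u, v) \<in> parcs G" if "u \<in> V" "v \<in> V" for u v
    using that unfolding parcs_iff by blast
  moreover have "pverts G = V" by (simp add: G_def)
  ultimately show ?thesis by (simp add: aut_group_def flip: \<phi>_def)
qed

text \<open>In coordinate \<open>i\<close> a factor automorphism moves one arc to the other. In any
  other coordinate the ends of each arc agree, so only a single value has to be moved.\<close>

lemma aut_arc_dir_transitive:
  assumes i: "i \<le> r" and uv: "arc_dir i u v" "arc_dir i u' v'"
  obtains \<phi> where "\<phi> \<in> carrier (aut_group G)" "\<phi> u = u'" "\<phi> v = v'"
proof -
  have V: "u \<in> V" "v \<in> V" "u' \<in> V" "v' \<in> V" using uv by (auto simp: arc_dir_def)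
  define P where "P j \<sigma> \<longleftrightarrow> inj_on \<sigma> {0..<int (n j)} \<and> \<sigma> ` {0..<int (n j)} \<subseteq> {0..<int (n j)} \<and>
    (\<forall>x\<in>{0..<int (n j)}. \<forall>y\<in>{0..<int (n j)}. R j (\<sigma> x) (\<sigma> y) \<longleftrightarrow> R j x y) \<and>
    \<sigma> (c u j) = c u' j \<and> \<sigma> (c v j) = c v' j" for j \<sigma>
  have "\<exists>\<sigma>. P j \<sigma>" if j: "j \<le> r" for j
  proof -
    have range: "c w j \<in> {0..<int (n j)}" if "w \<in> V" for w
      using F_range[OF c_F[OF that] j] .
    show ?thesis
    proof (cases "j = i")
      case True
      then have R: "R j (c u j) (c v j)" "R j (c u' j) (c v' j)"
        using uv by (auto simp: arc_dir_def)
      obtain \<sigma> where "inj_on \<sigma> {0..<int (n j)}" "\<sigma> ` {0..<int (n j)} \<subseteq> {0..<int (n j)}"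
        "\<And>x y. x \<in> {0..<int (n j)} \<Longrightarrow> y \<in> {0..<int (n j)} \<Longrightarrow> R j (\<sigma> x) (\<sigma> y) \<longleftrightarrow> R j x y"
        "\<sigma> (c u j) = c u' j" "\<sigma> (c v j) = c v' j"
        by (rule factor_arc_transitive[OF j range range range range R]) (use V in auto)
      then show ?thesis unfolding P_def by blast
    next
      case False
      then have eq: "c v j = c u j" "c v' j = c u' j" using uv j by (auto simp: arc_dir_def)
      \<comment> \<open>\<open>q a\<close> is an artificial neighbour of \<open>a\<close> with value
        0 or 1. It turns moving a single value into a case of
        \<open>factor_arc_transitive\<close>.\<close>
      define q :: "int \<Rightarrow> int" where "q a = (if even a then 1 else 0)" for a
      have q: "q a \<in> {0..<int (n j)}" "R j a (q a)" for a
        using n_ge_2[OF j] by (auto simp: q_def R_def)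
      obtain \<sigma> where "inj_on \<sigma> {0..<int (n j)}" "\<sigma> ` {0..<int (n j)} \<subseteq> {0..<int (n j)}"
        "\<And>x y. x \<in> {0..<int (n j)} \<Longrightarrow> y \<in> {0..<int (n j)} \<Longrightarrow> R j (\<sigma> x) (\<sigma> y) \<longleftrightarrow> R j x y"
        "\<sigma> (c u j) = c u' j"
        by (rule factor_arc_transitive[OF j range q(1) range q(1) q(2) q(2), of u u']) (use V in auto)
      then show ?thesis unfolding P_def eq by blast
    qed
  qed
  then obtain \<sigma> where \<sigma>: "\<And>j. j \<le> r \<Longrightarrow> P j (\<sigma> j)" by metis
  have image: "dec (\<lambda>j\<in>{..r}. \<sigma> j (c w j)) = w'"
    if "w' \<in> V" "\<And>j. j \<le> r \<Longrightarrow> \<sigma> j (c w j) = c w' j" for w w'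
  proof -
    have "(\<lambda>j\<in>{..r}. \<sigma> j (c w j)) = c w'"
    proof
      fix j show "(\<lambda>j\<in>{..r}. \<sigma> j (c w j)) j = c w' j"
        using c_F[OF that(1)] that(2)[of j] by (cases "j \<le> r") (auto simp: PiE_iff extensional_def)
    qed
    then show ?thesis using that(1) by (simp add: dec_c)
  qed
  show thesis
  proof
    show "(\<lambda>v\<in>V. dec (\<lambda>j\<in>{..r}. \<sigma> j (c v j))) \<in> carrier (aut_group G)"
      using \<sigma> unfolding P_def by (intro coordinatewise_aut) blast+
    show "(\<lambda>v\<in>V. dec (\<lambda>j\<in>{..r}. \<sigma> j (c v j))) u = u'"
      using \<sigma> V image[of u' u] by (simp add: P_def)
    show "(\<lambda>v\<in>V. dec (\<lambda>j\<in>{..r}. \<sigma> j (c v j))) v = v'"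
      using \<sigma> V image[of v' v] by (simp add: P_def)
  qed
qed

section \<open>Common neighbours as an invariant of the direction\<close>

definition codegree :: "'a set \<Rightarrow> nat" where
  "codegree e = card {w \<in> V. \<forall>z\<in>e. (z, w) \<in> parcs G}"

lemma aut_G:
  assumes "\<phi> \<in> carrier (aut_group G)"
  shows "bij_betw \<phi> V V"
    and "u \<in> V \<Longrightarrow> v \<in> V \<Longrightarrow> (\<phi> u, \<phi> v) \<in> parcs G \<longleftrightarrow> (u, v) \<in> parcs G"
  using assms by (auto simp: aut_group_def Bij_def G_def)

lemma codegree_aut:
  assumes \<phi>: "\<phi> \<in> carrier (aut_group G)" and e: "e \<subseteq> V"
  shows "codegree (\<phi> ` e) = codegree e"
proof -
  have "bij_betw \<phi> {w \<in> V. \<forall>z\<in>e. (z, w) \<in> parcs G} {w \<in> V. \<forall>z\<in>\<phi> ` e. (z, w) \<in> parcs G}"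
    unfolding bij_betw_def
  proof
    show "inj_on \<phi> {w \<in> V. \<forall>z\<in>e. (z, w) \<in> parcs G}"
      using aut_G(1)[OF \<phi>] by (auto simp: bij_betw_def intro: inj_on_subset)
    have iff: "(\<forall>z\<in>\<phi> ` e. (z, \<phi> w) \<in> parcs G) \<longleftrightarrow> (\<forall>z\<in>e. (z, w) \<in> parcs G)" if "w \<in> V" for w
      using aut_G(2)[OF \<phi> _ that] e by blast
    have "{w \<in> V. \<forall>z\<in>\<phi> ` e. (z, w) \<in> parcs G} = {w \<in> \<phi> ` V. \<forall>z\<in>\<phi> ` e. (z, w) \<in> parcs G}"
      using aut_G(1)[OF \<phi>] by (simp add: bij_betw_def)
    also have "\<dots> = \<phi> ` {w \<in> V. \<forall>z\<in>\<phi> ` e. (z, \<phi> w) \<in> parcs G}" by blast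
    also have "{w \<in> V. \<forall>z\<in>\<phi> ` e. (z, \<phi> w) \<in> parcs G} = {w \<in> V. \<forall>z\<in>e. (z, w) \<in> parcs G}"
      using iff by blast
    finally show "\<phi> ` {w \<in> V. \<forall>z\<in>e. (z, w) \<in> parcs G} = {w \<in> V. \<forall>z\<in>\<phi> ` e. (z, w) \<in> parcs G}" ..
  qed
  then show ?thesis unfolding codegree_def by (simp add: bij_betw_same_card)
qed

definition dir_codegree :: "nat \<Rightarrow> nat" where
  "dir_codegree i = (if i = r then 0 else n i - 2)"

text \<open>All three edges of a triangle have the same direction, so triangles lie within a single
  factor: \<open>n i - 2\<close> choices for the third vertex remain in a clique and none in the
  bipartite factor.\<close>

lemma codegree_arc:
  assumes i: "i \<le> r" and uv: "arc_dir i u v"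
  shows "codegree {u, v} = dir_codegree i"
proof -
  have V: "u \<in> V" "v \<in> V" using uv by (auto simp: arc_dir_def)
  have neq: "c x k \<noteq> c y k" if "arc_dir k x y" for k x y
    using that R_irrefl by (auto simp: arc_dir_def)
  have dir: "arc_dir i u w \<and> arc_dir i v w" if w: "(u, w) \<in> parcs G" "(v, w) \<in> parcs G" for w
  proof -
    obtain j where j: "j \<le> r" "arc_dir j u w" using w(1) unfolding parcs_iff by blast
    obtain k where k: "k \<le> r" "arc_dir k v w" using w(2) unfolding parcs_iff by blast
    note jk = j(1) k(1) j(2) k(2)
    have coords: "\<And>l. l \<le> r \<Longrightarrow> l \<noteq> i \<Longrightarrow> c v l = c u l"
      "\<And>l. l \<le> r \<Longrightarrow> l \<noteq> j \<Longrightarrow> c w l = c u l" "\<And>l. l \<le> r \<Longrightarrow> l \<noteq> k \<Longrightarrow> c w l = c v l"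
      using uv jk by (auto simp: arc_dir_def)
    \<comment> \<open>If \<open>w\<close> differed from \<open>u\<close> in a coordinate
      \<open>j\<close> other than \<open>i\<close>, then \<open>w\<close> would have to differ from
      \<open>v\<close> in \<open>j\<close> alone as well, although \<open>u\<close> and
      \<open>v\<close> differ in \<open>i\<close>.\<close>
    have "j = i"
    proof (rule ccontr)
      assume "j \<noteq> i"
      then have "k = j" using coords(1,3)[of j] neq[OF jk(3)] jk by metis
      then show False using coords(2,3)[of i] i neq[OF uv] \<open>j \<noteq> i\<close> by metis
    qed
    moreover have "k = i"
      using coords(1,2)[of k] neq[OF jk(4)] jk(2) \<open>j = i\<close> by metis
    ultimately show ?thesis using jk by simp
  qed
  show ?thesis
  proof (cases "i = r")
    case True
    have "{w \<in> V. \<forall>z\<in>{u, v}. (z, w) \<in> parcs G} = {}"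
    proof (rule ccontr)
      assume "{w \<in> V. \<forall>z\<in>{u, v}. (z, w) \<in> parcs G} \<noteq> {}"
      then obtain w where "(u, w) \<in> parcs G" "(v, w) \<in> parcs G" by auto
      from dir[OF this] uv show False using True by (auto simp: arc_dir_def R_def)
    qed
    then have "codegree {u, v} = 0" unfolding codegree_def by (simp only: card.empty)
    then show ?thesis using True by (simp add: dir_codegree_def)
  next
    case False
    let ?I = "{0..<int (n i)} - {c u i, c v i}"
    let ?h = "\<lambda>a. dec ((c u)(i := a))"
    have F: "(c u)(i := a) \<in> F" if "a \<in> {0..<int (n i)}" for a
      by (rule upd_F[OF c_F[OF V(1)] i that])
    have "{w \<in> V. \<forall>z\<in>{u, v}. (z, w) \<in> parcs G} = ?h ` ?I"
    proof (intro equalityI subsetI)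
      fix w assume w: "w \<in> {w \<in> V. \<forall>z\<in>{u, v}. (z, w) \<in> parcs G}"
      then have wd: "arc_dir i u w" "arc_dir i v w" using dir by auto
      have "c w = (c u)(i := c w i)"
      proof
        fix j show "c w j = ((c u)(i := c w i)) j"
          using wd(1) c_F[of w] c_F[of u]
          by (cases "j \<le> r") (auto simp: arc_dir_def PiE_iff extensional_def)
      qed
      then have "w = ?h (c w i)" using w by (metis (mono_tags, lifting) dec_c mem_Collect_eq)
      moreover have "c w i \<in> ?I"
        using neq[OF wd(1)] neq[OF wd(2)] F_range[OF c_F i, of w] w by auto
      ultimately show "w \<in> ?h ` ?I" by (rule image_eqI)
    next
      fix w assume "w \<in> ?h ` ?I"
      then obtain a where a: "a \<in> ?I" "w = ?h a" by blast
      then have "w \<in> V" and cw: "c w = (c u)(i := a)" using F by (simp_all add: dec_V c_dec)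
      then have "arc_dir i u w" "arc_dir i v w"
        using a uv False by (auto simp: arc_dir_def R_def)
      then show "w \<in> {w \<in> V. \<forall>z\<in>{u, v}. (z, w) \<in> parcs G}"
        using i \<open>w \<in> V\<close> by (auto simp: parcs_iff)
    qed
    moreover have "inj_on ?h ?I"
    proof (rule inj_onI)
      fix a b assume ab: "a \<in> ?I" "b \<in> ?I" "?h a = ?h b"
      then have "(c u)(i := a) = (c u)(i := b)" using F c_dec by (metis DiffD1)
      then show "a = b" by (metis fun_upd_same)
    qed
    ultimately have "codegree {u, v} = card ?I" by (simp add: codegree_def card_image)
    also have "\<dots> = n i - 2"
      using neq[OF uv] F_range[OF c_F i] V by (simp add: card_Diff_subset)
    finally show ?thesis using False by (simp add: dir_codegree_def)
  qed
qed

text \<open>As each clique size is at least 3, cliques have positive values, distinct from the 0 of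
  direction \<open>r\<close>; among cliques the sizes \<open>n i\<close> are distinct.\<close>

lemma inj_dir_codegree: "inj_on dir_codegree {..r}"
proof (rule inj_onI)
  fix i j
  assume ij: "i \<in> {..r}" "j \<in> {..r}"
    and eq: "dir_codegree i = dir_codegree j"
  have pos: "0 < n k - 2" if "k < r" for k using n_ge_3[OF that] by simp
  consider "i = r" "j = r" | "i < r" "j < r" "n i - 2 = n j - 2"
    using ij eq pos[of i] pos[of j]
    by (cases "i = r"; cases "j = r") (auto simp: dir_codegree_def)
  then show "i = j"
  proof cases
    case 2
    then have "n i = n j" using pos[of i] pos[of j] by linarith
    then show ?thesis using inj_onD[OF inj_n] 2 by blast
  qed simp
qed

lemma codegree_eq_iff:
  assumes "i \<le> r" "j \<le> r" "arc_dir i u v" "arc_dir j u' v'"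
  shows "codegree {u, v} = codegree {u', v'} \<longleftrightarrow> i = j"
  using inj_on_eq_iff[OF inj_dir_codegree, of i j] codegree_arc assms by auto

text \<open>Every direction occurs, by \<open>arc_dir_exists\<close>, so all \<open>r + 1\<close>
  values are attained.\<close>

lemma codegree_parcs: "card ((\<lambda>(u, v). codegree {u, v}) ` parcs G) = r + 1"
proof -
  have "(\<lambda>(u, v). codegree {u, v}) ` parcs G = dir_codegree ` {..r}"
  proof (intro equalityI subsetI)
    fix t assume "t \<in> (\<lambda>(u, v). codegree {u, v}) ` parcs G"
    then obtain u v i where "i \<le> r" "arc_dir i u v" "t = codegree {u, v}"
      using parcs_iff by auto
    then show "t \<in> dir_codegree ` {..r}"
      using codegree_arc by (intro image_eqI[of _ _ i]) auto
  next
    fix t assume "t \<in> dir_codegree ` {..r}"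
    then obtain i where i: "i \<le> r" "t = dir_codegree i" by auto
    obtain u v where uv: "arc_dir i u v" using arc_dir_exists[OF i(1)] .
    then show "t \<in> (\<lambda>(u, v). codegree {u, v}) ` parcs G"
      using codegree_arc[OF i(1) uv] i parcs_iff by (intro image_eqI[of _ _ "(u, v)"]) auto
  qed
  then show ?thesis using inj_dir_codegree by (simp add: card_image)
qed

section \<open>The two orbit counts\<close>

lemma parcs_V: "(u, v) \<in> parcs G \<Longrightarrow> u \<in> V \<and> v \<in> V"
  by (simp add: G_def)

text \<open>Codegree is a complete invariant: automorphisms preserve it, equal values mean equal
  direction by \<open>codegree_eq_iff\<close>, and arcs of one direction are connected by
  automorphisms.\<close>

lemma num_arc_orbits_G: "num_arc_orbits G = r + 1"
proof -
  have "num_arc_orbits G = card ((\<lambda>(u, v). codegree {u, v}) ` parcs G)"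
    unfolding num_arc_orbits_def
  proof (rule card_orbits_eq)
    fix x y assume xy: "x \<in> parcs G" "y \<in> parcs G"
    obtain u v where x: "x = (u, v)" by fastforce
    obtain u' v' where y: "y = (u', v')" by fastforce
    obtain i j where ij: "i \<le> r" "j \<le> r" "arc_dir i u v" "arc_dir j u' v'"
      using xy x y parcs_iff by blast
    show "y \<in> orbit (aut_group G) (\<lambda>f. map_prod f f) x \<longleftrightarrow>
      (\<lambda>(u, v). codegree {u, v}) x = (\<lambda>(u, v). codegree {u, v}) y"
    proof
      assume "y \<in> orbit (aut_group G) (\<lambda>f. map_prod f f) x"
      then obtain \<phi> where \<phi>: "\<phi> \<in> carrier (aut_group G)" "u' = \<phi> u" "v' = \<phi> v"
        by (auto simp: orbit_def x y)
      have "codegree {u', v'} = codegree {u, v}"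
        using codegree_aut[OF \<phi>(1), of "{u, v}"] \<phi> parcs_V xy(1) x by simp
      then show "(\<lambda>(u, v). codegree {u, v}) x = (\<lambda>(u, v). codegree {u, v}) y"
        by (simp add: x y)
    next
      assume "(\<lambda>(u, v). codegree {u, v}) x = (\<lambda>(u, v). codegree {u, v}) y"
      then have "i = j" using codegree_eq_iff[OF ij] by (simp add: x y)
      then obtain \<phi> where "\<phi> \<in> carrier (aut_group G)" "\<phi> u = u'" "\<phi> v = v'"
        using aut_arc_dir_transitive ij by metis
      then show "y \<in> orbit (aut_group G) (\<lambda>f. map_prod f f) x"
        unfolding orbit_def x y by (auto intro!: exI[of _ \<phi>])
    qed
  next
    fix x assume "x \<in> parcs G"
    then show "orbit (aut_group G) (\<lambda>f. map_prod f f) x \<subseteq> parcs G"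
      using aut_G(2) parcs_V by (cases x) (auto simp: orbit_def)
  qed
  then show ?thesis by (simp only: codegree_parcs)
qed

text \<open>Each edge is given an arbitrary orientation: the codegree does not depend on it, and an
  automorphism that matches the oriented arcs matches the edges.\<close>

lemma num_edge_orbits_G: "num_edge_orbits G = r + 1"
proof -
  have edgesE: "\<exists>u v. (u, v) \<in> parcs G \<and> e = {u, v}" if "e \<in> edges G" for e
    using that by (auto simp: edges_def)
  have "num_edge_orbits G = card (codegree ` edges G)"
    unfolding num_edge_orbits_def
  proof (rule card_orbits_eq)
    fix x y assume xy: "x \<in> edges G" "y \<in> edges G"
    obtain u v where x: "x = {u, v}" "(u, v) \<in> parcs G" using edgesE xy by blast
    obtain u' v' where y: "y = {u', v'}" "(u', v') \<in> parcs G" using edgesE xy by blast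
    obtain i j where ij: "i \<le> r" "j \<le> r" "arc_dir i u v" "arc_dir j u' v'"
      using x y parcs_iff by blast
    show "y \<in> orbit (aut_group G) (\<lambda>f e. f ` e) x \<longleftrightarrow> codegree x = codegree y"
    proof
      assume "y \<in> orbit (aut_group G) (\<lambda>f e. f ` e) x"
      then obtain \<phi> where \<phi>: "\<phi> \<in> carrier (aut_group G)" "y = \<phi> ` x"
        by (auto simp: orbit_def)
      then show "codegree x = codegree y"
        using codegree_aut[OF \<phi>(1), of x] x parcs_V by auto
    next
      assume "codegree x = codegree y"
      then have "i = j" using codegree_eq_iff[OF ij] by (simp add: x y)
      then obtain \<phi> where \<phi>: "\<phi> \<in> carrier (aut_group G)" "\<phi> u = u'" "\<phi> v = v'"
        using aut_arc_dir_transitive ij by metis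
      then have "y = \<phi> ` x" by (simp add: x y)
      then show "y \<in> orbit (aut_group G) (\<lambda>f e. f ` e) x"
        using \<phi>(1) unfolding orbit_def by blast
    qed
  next
    fix x assume "x \<in> edges G"
    then obtain u v where x: "x = {u, v}" "(u, v) \<in> parcs G" using edgesE by blast
    have "\<phi> ` x \<in> edges G" if "\<phi> \<in> carrier (aut_group G)" for \<phi>
      using aut_G(2)[OF that] x parcs_V[OF x(2)]
      unfolding edges_def by (intro image_eqI[of _ _ "(\<phi> u, \<phi> v)"]) auto
    then show "orbit (aut_group G) (\<lambda>f e. f ` e) x \<subseteq> edges G"
      by (auto simp: orbit_def)
  qed
  also have "codegree ` edges G = (\<lambda>(u, v). codegree {u, v}) ` parcs G"
    by (simp add: edges_def image_image case_prod_unfold)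
  finally show ?thesis by (simp only: codegree_parcs)
qed

end

section \<open>Infinitely many graphs\<close>

lemma digraph_iso_card_verts:
  assumes "digraph_iso G H"
  shows "card (verts G) = card (verts H)"
proof -
  from assms obtain f where f: "pre_digraph.digraph_isomorphism G f" "H = app_iso f G"
    by (auto simp: digraph_iso_def)
  then have "inj_on (iso_verts f) (verts G)" by (simp add: pre_digraph.digraph_isomorphism_def)
  then show ?thesis using f by (simp add: card_image)
qed

lemma large_clique_biclique_product:
  assumes "2 \<le> k"
  obtains G :: "nat pair_pre_digraph" where "cayley_graph G" "nut_graph G"
    "num_edge_orbits G = k" "num_arc_orbits G = k" "N < card (pverts G)"
proof -
  define r where "r = k - 1"
  \<comment> \<open>The offsets make the clique sizes distinct and larger than \<open>r\<close>, 2
    and \<open>N\<close>. The other branch is twice the degree \<open>d\<close> of the clique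
    product, with the sum written out.\<close>
  define n where "n i = (if i < r then N + r + 3 + i else 2 * (\<Sum>i<r. N + r + 3 + i - 1))" for i
  define F where "F = PiE {..r} (\<lambda>i. {0..<int (n i)})"
  have "finite F" unfolding F_def by (rule finite_PiE) auto
  \<comment> \<open>Numbering the elements of \<open>F\<close> gives vertices of type
    \<open>nat\<close>.\<close>
  then obtain c where c: "bij_betw c {0..<card F} F" using ex_bij_betw_nat_finite by blast
  interpret clique_biclique_product r n "{0..<card F}" c
  proof
    show "bij_betw c {0..<card F} (PiE {..r} (\<lambda>i. {0..<int (n i)}))"
      using c by (simp add: F_def)
    show "inj_on n {..<r}" by (rule inj_onI) (simp add: n_def)
    show "n r = 2 * (\<Sum>i<r. n i - 1)" by (simp add: n_def)
  qed (use assms in \<open>auto simp: n_def r_def\<close>)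
  have "N < n 0" using r_pos by (simp add: n_def)
  then have "N < card (pverts G)" using n_le_card_V[of 0] by (simp add: G_def)
  then show thesis
    using that cayley_G nut_G num_edge_orbits_G num_arc_orbits_G assms r_def by auto
qed

theorem theorem5:
  fixes k :: nat
  assumes "k \<ge> 2"
  shows "\<exists>\<G> :: nat pair_pre_digraph set.
    infinite \<G> \<and>
    pairwise (\<lambda>G H. \<not> digraph_iso (with_proj G) (with_proj H)) \<G> \<and>
    (\<forall>G \<in> \<G>. cayley_graph G \<and> nut_graph G \<and>
       num_edge_orbits G = k \<and> num_arc_orbits G = k)"
proof -
  define P where "P G \<longleftrightarrow> cayley_graph G \<and> nut_graph G \<and>
    num_edge_orbits G = k \<and> num_arc_orbits G = k" for G :: "nat pair_pre_digraph"
  \<comment> \<open>\<open>C\<close> collects the vertex counts that occur. It is unbounded, and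
    choosing one graph for each count yields infinitely many graphs, no two of them
    isomorphic.\<close>
  define C where "C = (\<lambda>G. card (pverts G)) ` {G. P G}"
  have "\<exists>m\<in>C. N < m" for N
  proof -
    obtain G :: "nat pair_pre_digraph" where "cayley_graph G" "nut_graph G"
      "num_edge_orbits G = k" "num_arc_orbits G = k" "N < card (pverts G)"
      by (rule large_clique_biclique_product[OF assms])
    then show ?thesis unfolding C_def P_def by blast
  qed
  then have "infinite C" by (metis finite_nat_set_iff_bounded_le leD)
  define g where "g = inv_into {G. P G} (\<lambda>G. card (pverts G))"
  have g: "P (g m)" "card (pverts (g m)) = m" if "m \<in> C" for m
    using inv_into_into[of m "\<lambda>G. card (pverts G)" "{G. P G}"] f_inv_into_f[of m "\<lambda>G. card (pverts G)" "{G. P G}"] that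
    by (auto simp: C_def g_def)
  show ?thesis
  proof (intro exI conjI)
    have "inj_on g C" using g(2) by (metis inj_onI)
    then show "infinite (g ` C)" using \<open>infinite C\<close> finite_imageD by blast
    show "pairwise (\<lambda>G H. \<not> digraph_iso (with_proj G) (with_proj H)) (g ` C)"
    proof (rule pairwiseI)
      fix G H assume "G \<in> g ` C" "H \<in> g ` C" "G \<noteq> H"
      then have "card (pverts G) \<noteq> card (pverts H)" using g(2) by auto
      then show "\<not> digraph_iso (with_proj G) (with_proj H)"
        using digraph_iso_card_verts[of "with_proj G" "with_proj H"] by (auto simp: with_proj_def)
    qed
    show "\<forall>G\<in>g ` C. cayley_graph G \<and> nut_graph G \<and>
        num_edge_orbits G = k \<and> num_arc_orbits G = k"
      using g(1) by (auto simp: P_def)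
  qed
qed

end
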